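(* Let $\mathcal{X}$ be a finite-dimensional complex Hilbert space and let $\mathrm{D}(\mathcal{X})$ be the set of density operators on $\mathcal{X}$. Suppose the loss at each round $t\in\{1,\dots,T\}$ is of the form $\ell_t(\operatorname{tr}(E_t\omega_t))$, where $\ell_t:\mathbb{R}\to\mathbb{R}$ is convex and $L$-Lipschitz. Assume further that $\|E_t\|_F\le B$ for all $t\in\{1,\dots,T\}$. Then the regret of projected online gradient descent (OGD) satisfies \[ R_T \le D\,L\,B\,\sqrt{T}, \] where $D$ denotes the diameter of $\mathrm{D}(\mathcal{X})$ with respect to the Frobenius norm.
   Context: $\mathrm{D}(\mathcal{X})=\{\omega\in\mathcal{L}(\mathcal{X}) : \omega\succeq 0,\ \operatorname{tr}(\omega)=1\}$, where $\mathcal{L}(\mathcal{X})$ is the space of linear operators on $\mathcal{X}$; $\|X\|_F=\sqrt{\operatorname{tr}(X^\dagger X)}$ is the Frobenius norm; $\mathbb{1}$ is the identity operator; $X\preceq Y$ means $Y-X$ is positive semidefinite. Online protocol: in each round $t=1,\dots,T$ the learner reveals $\omega_t\in\mathrm{D}(\mathcal{X})$; the adversary then selects and reveals a measurement operator $E_t$ with $0\preceq E_t\preceq\mathbb{1}$ and a loss function $\ell_t$; the learner incurs the loss $\ell_t(\operatorname{tr}(E_t\omega_t))$. The regret is \[ R_T=\max_{\ell_1,\dots,\ell_T}\Big(\sum_{t=1}^T \ell_t\big(\operatorname{tr}(E_t\omega_t)\big)-\min_{\omega\in\mathrm{D}(\mathcal{X})}\sum_{t=1}^T \ell_t\big(\operatorname{tr}(E_t\omega)\big)\Big).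 \] Projected online gradient descent (OGD): the inputs are $T$, $\mathcal{X}$ and a step size $\eta>0$. Set $\omega_1=\mathbb{1}/\dim(\mathcal{X})$. For $t=1,\dots,T-1$, let $\nabla_t=\ell_t'(\operatorname{tr}(\omega_tE_t))\,E_t$, where $\ell_t'(x)$ denotes a (sub)derivative of $\ell_t$ at $x$, and set $\omega_{t+1}=\Pi_{\mathrm{D}(\mathcal{X})}(\omega_t-\eta\nabla_t)$, where $\Pi_{\mathrm{D}(\mathcal{X})}$ is the projection onto $\mathrm{D}(\mathcal{X})$ with respect to the Frobenius norm.
   Formalization: The bound fails for an arbitrary step size (e.g. a tiny one), so it is stated for a suitable step size η>0, depending only on T, L, B and the space, chosen before the measurements, losses and subderivatives. *)

theory Defs
  imports "HOL-Analysis.Analysis" "HOL-Library.Extended_Real"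
begin

text \<open>
  A (nonzero) finite-dimensional complex Hilbert space is represented, through an orthonormal
  basis indexed by a finite type, as \<open>complex ^ 'n\<close>; its operators are the matrices
  \<open>complex ^ 'n ^ 'n\<close>, and its dimension is \<open>CARD('n)\<close>.
\<close>

definition cadjoint :: "complex ^ 'n ^ 'm \<Rightarrow> complex ^ 'm ^ 'n" where
  "cadjoint A = (\<chi> i j. cnj (A $ j $ i))"

definition cinner :: "complex ^ 'n \<Rightarrow> complex ^ 'n \<Rightarrow> complex" where
  "cinner v w = (\<Sum>i\<in>UNIV. cnj (v $ i) * w $ i)"

definition psd :: "complex ^ 'n ^ 'n \<Rightarrow> bool" where
  "psd A \<longleftrightarrow> cadjoint A = A \<and> (\<forall>v. 0 \<le> Re (cinner v (A *v v)))"

definition loewner_le :: "complex ^ 'n ^ 'n \<Rightarrow> complex ^ 'n ^ 'n \<Rightarrow> bool"  (infix "\<preceq>" 50) where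
  "X \<preceq> Y \<longleftrightarrow> psd (Y - X)"

definition density_ops :: "(complex ^ 'n ^ 'n) set" where
  "density_ops = {\<omega>. 0 \<preceq> \<omega> \<and> trace \<omega> = 1}"

definition frob_norm :: "complex ^ 'n ^ 'n \<Rightarrow> real" where
  "frob_norm X = sqrt (Re (trace (cadjoint X ** X)))"

text \<open>
  The Frobenius norm is the norm the library puts on \<open>complex ^ 'n ^ 'n\<close>.  Hence the library's
  \<^const>\<open>diameter\<close> and \<^const>\<open>closest_point\<close> on this type are the diameter and the projection
  with respect to the Frobenius norm.
\<close>

lemma frob_norm_eq_norm: "frob_norm X = norm X"
proof -
  have "Re (trace (cadjoint X ** X)) = (\<Sum>i\<in>UNIV. \<Sum>j\<in>UNIV. (cmod (X $ j $ i))\<^sup>2)"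
    by (simp add: trace_def matrix_matrix_mult_def cadjoint_def cmod_power2
        flip: power2_eq_square)
  also have "\<dots> = (\<Sum>j\<in>UNIV. \<Sum>i\<in>UNIV. (cmod (X $ j $ i))\<^sup>2)"
    by (rule sum.swap)
  finally show ?thesis
    by (simp add: frob_norm_def norm_vec_def L2_set_def sum_nonneg)
qed

lemma dist_eq_frob_norm: "dist X Y = frob_norm (X - Y)"
  by (simp add: frob_norm_eq_norm dist_norm)

text \<open>
  The trace of a product of two Hermitian operators is a real number, so reading it through
  \<^const>\<open>Re\<close> below loses nothing.
\<close>

lemma trace_hermitian_mult_real:
  assumes "cadjoint A = A" "cadjoint B = B"
  shows "Im (trace (A ** B)) = 0"
proof -
  have A: "cnj (A $ i $ j) = A $ j $ i" for i j
    using arg_cong[OF assms(1), of "\<lambda>M. M $ j $ i"] by (simp add: cadjoint_def)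
  have B: "cnj (B $ i $ j) = B $ j $ i" for i j
    using arg_cong[OF assms(2), of "\<lambda>M. M $ j $ i"] by (simp add: cadjoint_def)
  have "cnj (trace (A ** B)) = (\<Sum>i\<in>UNIV. \<Sum>j\<in>UNIV. A $ j $ i * B $ i $ j)"
    by (simp only: trace_def matrix_matrix_mult_def vec_lambda_beta cnj_sum complex_cnj_mult A B)
  also have "\<dots> = (\<Sum>j\<in>UNIV. \<Sum>i\<in>UNIV. A $ j $ i * B $ i $ j)"
    by (rule sum.swap)
  also have "\<dots> = trace (A ** B)"
    by (simp add: trace_def matrix_matrix_mult_def)
  finally show ?thesis
    by (simp add: complex_eq_iff)
qed

definition is_subderivative :: "(real \<Rightarrow> real) \<Rightarrow> real \<Rightarrow> real \<Rightarrow> bool" where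
  "is_subderivative f x g \<longleftrightarrow> (\<forall>y. f x + g * (y - x) \<le> f y)"

text \<open>
  A rule resolving the choice of a subderivative: \<open>s t f x\<close> is the value used for \<open>f'(x)\<close> in
  round \<open>t\<close>.  The dependence on \<open>t\<close> permits different choices for the same loss function in
  different rounds.
\<close>

definition subderivative_rule :: "(nat \<Rightarrow> (real \<Rightarrow> real) \<Rightarrow> real \<Rightarrow> real) \<Rightarrow> bool" where
  "subderivative_rule s \<longleftrightarrow>
    (\<forall>t f x. convex_on UNIV f \<longrightarrow> is_subderivative f x (s t f x))"

definition ogd_gradient ::
  "(nat \<Rightarrow> (real \<Rightarrow> real) \<Rightarrow> real \<Rightarrow> real) \<Rightarrow> (nat \<Rightarrow> complex ^ 'n ^ 'n) \<Rightarrow> (nat \<Rightarrow> real \<Rightarrow> real) \<Rightarrow>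
    nat \<Rightarrow> complex ^ 'n ^ 'n \<Rightarrow> complex ^ 'n ^ 'n" where
  "ogd_gradient s E \<l> t \<omega> = s t (\<l> t) (Re (trace (\<omega> ** E t))) *\<^sub>R E t"

text \<open>Rounds are numbered from 1; the value at index 0 is never used.\<close>

primrec ogd ::
  "(nat \<Rightarrow> (real \<Rightarrow> real) \<Rightarrow> real \<Rightarrow> real) \<Rightarrow> real \<Rightarrow> (nat \<Rightarrow> complex ^ 'n ^ 'n) \<Rightarrow>
    (nat \<Rightarrow> real \<Rightarrow> real) \<Rightarrow> nat \<Rightarrow> complex ^ 'n ^ 'n" where
  "ogd s \<eta> E \<l> 0 = (1 / real CARD('n)) *\<^sub>R mat 1"
| "ogd s \<eta> E \<l> (Suc t) =
    (if t = 0 then (1 / real CARD('n)) *\<^sub>R mat 1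
     else closest_point density_ops
            (ogd s \<eta> E \<l> t - \<eta> *\<^sub>R ogd_gradient s E \<l> t (ogd s \<eta> E \<l> t)))"

text \<open>
  The regret over \<open>T\<close> rounds, the maximum being over losses from the class \<open>F\<close>.  The learner is
  a function of the loss functions, since its states depend on those revealed so far.
  Maximum and minimum are rendered as supremum and infimum in the extended reals, where they
  always exist.
\<close>

definition regret ::
  "nat \<Rightarrow> (real \<Rightarrow> real) set \<Rightarrow> (nat \<Rightarrow> complex ^ 'n ^ 'n) \<Rightarrow>
    ((nat \<Rightarrow> real \<Rightarrow> real) \<Rightarrow> nat \<Rightarrow> complex ^ 'n ^ 'n) \<Rightarrow> ereal" where
  "regret T F E learner =
    (SUP \<l> \<in> {\<l>. \<forall>t\<in>{1..T}. \<l> t \<in> F}.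
       ereal (\<Sum>t=1..T. \<l> t (Re (trace (E t ** learner \<l> t))))
       - (INF \<omega> \<in> density_ops. ereal (\<Sum>t=1..T. \<l> t (Re (trace (E t ** \<omega>))))))"

end

theory Submission
  imports Defs
begin

text \<open>
  On Hermitian operators \<open>Re (tr (E \<omega>))\<close> is the Frobenius inner product, so linearising the convex
  losses at the iterates bounds the regret by \<open>\<Sum>\<^sub>t \<nabla>\<^sub>t \<bullet> (\<omega>\<^sub>t - \<omega>)\<close>.  Projection onto a convex set
  does not increase the distance to its points, whence by telescoping this sum is at most
  \<open>D\<^sup>2 / (2 \<eta>) + \<eta> L\<^sup>2 B\<^sup>2 T / 2\<close>; the step size \<open>\<eta> = D / (L B \<surd>T)\<close> balances the two terms.  If
  \<open>D L B T = 0\<close>, the Cauchy-Schwarz bound \<open>D L B\<close> on each summand suffices.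
\<close>

section \<open>Projected gradient descent in a Euclidean space\<close>

lemma projected_step_inner_le:
  fixes S :: "'a::{real_inner, heine_borel} set"
  assumes "convex S" "closed S" "u \<in> S" "\<eta> > 0" "norm g \<le> G"
  shows "g \<bullet> (x - u) \<le>
    ((norm (x - u))\<^sup>2 - (norm (closest_point S (x - \<eta> *\<^sub>R g) - u))\<^sup>2) / (2 * \<eta>) + \<eta> * G\<^sup>2 / 2"
proof -
  let ?y = "closest_point S (x - \<eta> *\<^sub>R g)"
  \<comment> \<open>The point \<open>u\<close> is its own projection, so nonexpansiveness compares
    the new iterate with the unprojected step; expanding the square of the latter exposes
    \<open>g \<bullet> (x - u)\<close> as the cross term.\<close>
  have "dist ?y (closest_point S u) \<le> dist (x - \<eta> *\<^sub>R g) u"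
    using assms by (intro closest_point_lipschitz) auto
  then have "norm (?y - u) \<le> norm ((x - u) - \<eta> *\<^sub>R g)"
    using assms by (simp add: closest_point_self dist_norm algebra_simps)
  then have "(norm (?y - u))\<^sup>2 \<le> (norm ((x - u) - \<eta> *\<^sub>R g))\<^sup>2"
    by (simp add: power_mono)
  also have "\<dots> = (norm (x - u))\<^sup>2 - 2 * \<eta> * (g \<bullet> (x - u)) + \<eta>\<^sup>2 * (norm g)\<^sup>2"
    by (simp only: power2_norm_eq_inner)
       (simp add: inner_diff_left inner_diff_right inner_commute algebra_simps power2_eq_square)
  also have "\<dots> \<le> (norm (x - u))\<^sup>2 - 2 * \<eta> * (g \<bullet> (x - u)) + \<eta>\<^sup>2 * G\<^sup>2"
    using assms by (simp add: power_mono mult_left_mono)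
  finally show ?thesis
    using \<open>\<eta> > 0\<close> by (simp add: field_simps power2_eq_square)
qed

lemma projected_gradient_descent_regret:
  fixes S :: "'a::{real_inner, heine_borel} set" and x g :: "nat \<Rightarrow> 'a"
  assumes "convex S" "closed S" "u \<in> S" "\<eta> > 0" "norm (x 1 - u) \<le> D"
    and step: "\<And>t. 1 \<le> t \<Longrightarrow> x (Suc t) = closest_point S (x t - \<eta> *\<^sub>R g t)"
    and G: "\<And>t. t \<in> {1..T} \<Longrightarrow> norm (g t) \<le> G"
  shows "(\<Sum>t=1..T. g t \<bullet> (x t - u)) \<le> D\<^sup>2 / (2 * \<eta>) + \<eta> * G\<^sup>2 * real T / 2"
proof -
  \<comment> \<open>The subtracted distance at \<open>Suc k\<close> is kept during the induction
    because the next one-step bound cancels it; only after the induction is it dropped.\<close>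
  have "(\<Sum>t=1..k. g t \<bullet> (x t - u)) \<le>
      ((norm (x 1 - u))\<^sup>2 - (norm (x (Suc k) - u))\<^sup>2) / (2 * \<eta>) + \<eta> * G\<^sup>2 * real k / 2"
    if "k \<le> T" for k
    using that
  proof (induction k)
    case (Suc k)
    have "g (Suc k) \<bullet> (x (Suc k) - u) \<le>
        ((norm (x (Suc k) - u))\<^sup>2 - (norm (x (Suc (Suc k)) - u))\<^sup>2) / (2 * \<eta>) + \<eta> * G\<^sup>2 / 2"
      using projected_step_inner_le[of S u \<eta> "g (Suc k)" G "x (Suc k)"] assms Suc.prems by simp
    with Suc show ?case
      by (simp add: diff_divide_distrib algebra_simps add_divide_distrib)
  qed simp
  from this[of T] have "(\<Sum>t=1..T. g t \<bullet> (x t - u)) \<le>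
      ((norm (x 1 - u))\<^sup>2 - (norm (x (Suc T) - u))\<^sup>2) / (2 * \<eta>) + \<eta> * G\<^sup>2 * real T / 2"
    by simp
  also have "((norm (x 1 - u))\<^sup>2 - (norm (x (Suc T) - u))\<^sup>2) / (2 * \<eta>) \<le> D\<^sup>2 / (2 * \<eta>)"
  proof (intro divide_right_mono)
    have "(norm (x 1 - u))\<^sup>2 \<le> D\<^sup>2"
      using assms(5) by (simp add: power_mono)
    then show "(norm (x 1 - u))\<^sup>2 - (norm (x (Suc T) - u))\<^sup>2 \<le> D\<^sup>2"
      by (smt (verit) zero_le_power2)
  qed (use \<open>\<eta> > 0\<close> in simp)
  finally show ?thesis by simp
qed

section \<open>Subderivatives, and the trace as an inner product\<close>

text \<open>Testing the subderivative inequality one unit to either side of \<open>x\<close> bounds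
  both \<open>g\<close> and \<open>-g\<close> by an increment of \<open>f\<close>.\<close>

lemma subderivative_abs_le_lipschitz:
  assumes "is_subderivative f x g" "L-lipschitz_on UNIV f"
  shows "\<bar>g\<bar> \<le> L"
proof -
  have "f (x + 1) - f x \<le> L" "f (x - 1) - f x \<le> L"
    using lipschitz_onD[OF assms(2), of "x + 1" x] lipschitz_onD[OF assms(2), of "x - 1" x]
    by (auto simp: dist_real_def)
  moreover have "f x + g \<le> f (x + 1)" "f x - g \<le> f (x - 1)"
    using assms(1)[unfolded is_subderivative_def, rule_format, of "x + 1"]
      assms(1)[unfolded is_subderivative_def, rule_format, of "x - 1"] by auto
  ultimately show ?thesis by linarith
qed

text \<open>For Hermitian \<open>E\<close> the trace equals that of \<open>cadjoint E ** X\<close>,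
  whose real part is the inner product inducing the Frobenius norm. This carries the Euclidean
  lemmas over to operators.\<close>

lemma trace_hermitian_mult_eq_inner:
  assumes "cadjoint E = E"
  shows "Re (trace (E ** X)) = E \<bullet> X"
proof -
  have E: "E $ i $ k = cnj (E $ k $ i)" for i k
    using arg_cong[OF assms, of "\<lambda>M. M $ i $ k"] by (simp add: cadjoint_def)
  have "Re (trace (E ** X)) = (\<Sum>i\<in>UNIV. \<Sum>k\<in>UNIV. Re (cnj (E $ k $ i) * X $ k $ i))"
    by (simp only: trace_def matrix_matrix_mult_def vec_lambda_beta Re_sum E[symmetric])
  also have "\<dots> = (\<Sum>k\<in>UNIV. \<Sum>i\<in>UNIV. Re (cnj (E $ k $ i) * X $ k $ i))"
    by (rule sum.swap)
  also have "\<dots> = E \<bullet> X"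
    by (simp add: inner_vec_def inner_complex_def)
  finally show ?thesis .
qed

section \<open>Convexity and closedness of the set of density operators\<close>

lemma cadjoint_add: "cadjoint (A + B) = cadjoint A + cadjoint B"
  by (simp add: cadjoint_def vec_eq_iff)

lemma cadjoint_scaleR: "cadjoint (c *\<^sub>R A) = c *\<^sub>R cadjoint A"
  by (simp add: cadjoint_def vec_eq_iff)

lemma cinner_mult_vec:
  "cinner v (A *v v) = (\<Sum>i\<in>UNIV. \<Sum>j\<in>UNIV. cnj (v $ i) * A $ i $ j * v $ j)"
  by (simp add: cinner_def matrix_vector_mult_def sum_distrib_left mult.assoc)

lemma cinner_add_mult_vec: "cinner v ((A + B) *v v) = cinner v (A *v v) + cinner v (B *v v)"
  by (simp add: cinner_def matrix_vector_mult_add_rdistrib ring_distribs sum.distrib)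

lemma cinner_scaleR_mult_vec: "cinner v ((c *\<^sub>R A) *v v) = c *\<^sub>R cinner v (A *v v)"
  by (simp add: cinner_mult_vec scaleR_sum_right)

lemma convex_density_ops: "convex (density_ops :: (complex ^ 'n ^ 'n) set)"
proof (rule convexI)
  fix X Y :: "complex ^ 'n ^ 'n" and a b :: real
  assume "X \<in> density_ops" "Y \<in> density_ops" and ab: "0 \<le> a" "0 \<le> b" "a + b = 1"
  then have X: "psd X" "trace X = 1" and Y: "psd Y" "trace Y = 1"
    by (auto simp: density_ops_def loewner_le_def)
  have "psd (a *\<^sub>R X + b *\<^sub>R Y)"
    using X Y ab
    by (auto simp: psd_def cadjoint_add cadjoint_scaleR cinner_add_mult_vec cinner_scaleR_mult_vec)
  moreover have "trace (a *\<^sub>R X + b *\<^sub>R Y) = 1"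
  proof -
    have "trace (a *\<^sub>R X + b *\<^sub>R Y) = a *\<^sub>R trace X + b *\<^sub>R trace Y"
      by (simp add: trace_def sum.distrib scaleR_sum_right)
    then show ?thesis
      using X Y ab by (simp flip: scaleR_left_distrib)
  qed
  ultimately show "a *\<^sub>R X + b *\<^sub>R Y \<in> density_ops"
    by (simp add: density_ops_def loewner_le_def)
qed

lemma closed_density_ops: "closed (density_ops :: (complex ^ 'n ^ 'n) set)"
proof -
  \<comment> \<open>Positivity becomes one closed condition for each fixed \<open>v\<close>, and
    closed sets are stable under arbitrary intersections.\<close>
  have eq: "density_ops = {X :: complex ^ 'n ^ 'n. cadjoint X = X} \<inter> {X. trace X = 1} \<inter>
      (\<Inter>v. {X. 0 \<le> Re (cinner v (X *v v))})"
    by (auto simp: density_ops_def loewner_le_def psd_def)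
  have 1: "closed {X :: complex ^ 'n ^ 'n. cadjoint X = X}"
    unfolding cadjoint_def by (intro closed_Collect_eq continuous_intros)
  have 2: "closed {X :: complex ^ 'n ^ 'n. trace X = 1}"
    unfolding trace_def by (intro closed_Collect_eq continuous_intros)
  have 3: "closed {X :: complex ^ 'n ^ 'n. 0 \<le> Re (cinner v (X *v v))}" for v
    unfolding cinner_mult_vec by (intro closed_Collect_le continuous_intros)
  show ?thesis
    unfolding eq by (intro closed_Int closed_INT ballI 1 2 3)
qed

section \<open>Boundedness of the set of density operators\<close>

text \<open>A vector supported on two coordinates sees only a 2 by 2 principal block. The weight
  \<open>c\<close> stays free so that its phase can isolate parts of the off-diagonal entry.\<close>

lemma cinner_axis_add_axis:
  fixes A :: "complex ^ 'n ^ 'n"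
  assumes "i \<noteq> j" and "v = (\<chi> k. if k = i then 1 else if k = j then c else 0)"
  shows "cinner v (A *v v) = A $ i $ i + c * A $ i $ j + cnj c * A $ j $ i + cnj c * A $ j $ j * c"
proof -
  \<comment> \<open>Applied twice below: to the inner sum of the quadratic form, then to the outer
    one.\<close>
  have sum2: "(\<Sum>k\<in>UNIV. f k) = f i + f j" if "\<And>k. k \<noteq> i \<Longrightarrow> k \<noteq> j \<Longrightarrow> f k = 0"
    for f :: "'n \<Rightarrow> complex"
  proof -
    have "(\<Sum>k\<in>UNIV. f k) = (\<Sum>k\<in>{i, j}. f k)"
      using that by (intro sum.mono_neutral_right) auto
    then show ?thesis using assms(1) by simp
  qed
  have v: "v $ i = 1" "v $ j = c" "\<And>k. k \<noteq> i \<Longrightarrow> k \<noteq> j \<Longrightarrow> v $ k = 0"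
    using assms by auto
  have "cinner v (A *v v) = (\<Sum>k\<in>UNIV. cnj (v $ k) * A $ k $ i * v $ i + cnj (v $ k) * A $ k $ j * v $ j)"
    unfolding cinner_mult_vec by (intro sum.cong refl sum2) (simp add: v)
  also have "\<dots> = cnj (v $ i) * A $ i $ i * v $ i + cnj (v $ i) * A $ i $ j * v $ j +
      (cnj (v $ j) * A $ j $ i * v $ i + cnj (v $ j) * A $ j $ j * v $ j)"
    by (rule sum2) (simp add: v)
  finally show ?thesis by (simp add: v algebra_simps)
qed

lemma psd_diagonal_nonneg:
  assumes "psd A"
  shows "0 \<le> Re (A $ i $ i)"
proof -
  have "cinner (axis i 1) (A *v axis i 1) = A $ i $ i"
  proof -
    have "cinner (axis i 1) (A *v axis i 1) =
        (\<Sum>k\<in>UNIV. if k = i then (A *v axis i 1) $ k else 0)"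
      unfolding cinner_def by (intro sum.cong) (auto simp: axis_def)
    also have "\<dots> = (\<Sum>k\<in>UNIV. A $ i $ k * axis i 1 $ k)"
      by (simp add: matrix_vector_mult_def)
    also have "\<dots> = (\<Sum>k\<in>UNIV. if k = i then A $ i $ k else 0)"
      by (intro sum.cong) (auto simp: axis_def)
    finally show ?thesis by simp
  qed
  moreover have "0 \<le> Re (cinner (axis i 1) (A *v axis i 1))"
    using assms by (simp add: psd_def)
  ultimately show ?thesis by simp
qed

lemma psd_entry_cmod_le:
  assumes "psd A"
  shows "cmod (A $ i $ j) \<le> Re (A $ i $ i) + Re (A $ j $ j)"
proof -
  have self: "cadjoint A = A"
    using assms by (simp add: psd_def)
  have her: "A $ k $ l = cnj (A $ l $ k)" for k l
    using arg_cong[OF self, of "\<lambda>M. M $ k $ l"] by (simp add: cadjoint_def)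
  have im: "Im (A $ k $ k) = 0" for k
    using arg_cong[OF her[of k k], of Im] by simp
  show ?thesis
  proof (cases "i = j")
    case True
    then show ?thesis
      using psd_diagonal_nonneg[OF assms, of i] im[of i] by (simp add: cmod_eq_Re)
  next
    case False
    have *: "0 \<le> Re (A $ i $ i) + 2 * Re (c * A $ i $ j) + (cmod c)\<^sup>2 * Re (A $ j $ j)" for c
    proof -
      have "0 \<le> Re (A $ i $ i + c * A $ i $ j + cnj c * A $ j $ i + cnj c * A $ j $ j * c)"
        using assms unfolding psd_def cinner_axis_add_axis[OF False refl, symmetric] by blast
      also have "\<dots> = Re (A $ i $ i) + 2 * Re (c * A $ i $ j) + (cmod c)\<^sup>2 * Re (A $ j $ j)"
        unfolding her[of j i] cmod_power2 by (simp add: im algebra_simps power2_eq_square)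
      finally show ?thesis .
    qed
    \<comment> \<open>The phases 1 and -1 bound twice the absolute real part by the sum of the two
      diagonal entries, \<open>\<i>\<close> and \<open>-\<i>\<close> do so for the imaginary part;
      half of each is added.\<close>
    have "\<bar>Re (A $ i $ j)\<bar> + \<bar>Im (A $ i $ j)\<bar> \<le> Re (A $ i $ i) + Re (A $ j $ j)"
      using *[of 1] *[of "-1"] *[of "\<i>"] *[of "-\<i>"] by simp
    then show ?thesis
      using cmod_le[of "A $ i $ j"] by linarith
  qed
qed

text \<open>Nonnegative diagonal entries summing to 1 are at most 1, so every entry has modulus at
  most 2. Boundedness is what makes \<open>diameter\<close> an actual bound on distances.\<close>

lemma bounded_density_ops: "bounded (density_ops :: (complex ^ 'n ^ 'n) set)"
proof (rule boundedI)
  fix X :: "complex ^ 'n ^ 'n"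
  assume "X \<in> density_ops"
  then have X: "psd X" "trace X = 1"
    by (auto simp: density_ops_def loewner_le_def)
  have diag: "Re (X $ i $ i) \<le> 1" for i
  proof -
    have "Re (X $ i $ i) \<le> (\<Sum>k\<in>UNIV. Re (X $ k $ k))"
      by (rule member_le_sum) (auto simp: psd_diagonal_nonneg X)
    also have "\<dots> = Re (trace X)" by (simp add: trace_def)
    finally show ?thesis using X by simp
  qed
  have "norm X \<le> (\<Sum>i\<in>UNIV. norm (X $ i))"
    unfolding norm_vec_def[of X] by (rule L2_set_le_sum) simp
  also have "\<dots> \<le> (\<Sum>i::'n\<in>UNIV. \<Sum>j::'n\<in>UNIV. 2)"
  proof (rule sum_mono)
    fix i
    have "norm (X $ i) \<le> (\<Sum>j\<in>UNIV. norm (X $ i $ j))"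
      unfolding norm_vec_def[of "X $ i"] by (rule L2_set_le_sum) simp
    also have "\<dots> \<le> (\<Sum>j::'n\<in>UNIV. 2)"
    proof (rule sum_mono)
      show "norm (X $ i $ j) \<le> 2" for j
        using psd_entry_cmod_le[OF X(1), of i j] diag[of i] diag[of j] by linarith
    qed
    finally show "norm (X $ i) \<le> (\<Sum>j::'n\<in>UNIV. 2)" .
  qed
  finally show "norm X \<le> (\<Sum>i::'n\<in>UNIV. \<Sum>j::'n\<in>UNIV. 2)" .
qed

section \<open>The iterates as density operators\<close>

lemma maximally_mixed_in_density_ops:
  "(1 / real CARD('n)) *\<^sub>R mat 1 \<in> (density_ops :: (complex ^ 'n ^ 'n) set)"
proof -
  have "cadjoint (mat 1 :: complex ^ 'n ^ 'n) = mat 1"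
    by (auto simp: cadjoint_def mat_def vec_eq_iff)
  moreover have "0 \<le> Re (cinner v (mat 1 *v v))" for v :: "complex ^ 'n"
    by (simp add: cinner_def sum_nonneg)
  moreover have "trace ((1 / real CARD('n)) *\<^sub>R mat 1 :: complex ^ 'n ^ 'n) =
      (1 / real CARD('n)) *\<^sub>R trace (mat 1 :: complex ^ 'n ^ 'n)"
    by (simp add: trace_def scaleR_sum_right del: sum_constant)
  ultimately show ?thesis
    by (simp add: density_ops_def loewner_le_def psd_def cadjoint_scaleR cinner_scaleR_mult_vec
        trace_I scaleR_complex.ctr complex_eq_iff)
qed

lemma ogd_in_density_ops: "(ogd s \<eta> E \<l> t :: complex ^ 'n ^ 'n) \<in> density_ops"
proof -
  note init = maximally_mixed_in_density_ops[where 'n = 'n]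
  \<comment> \<open>A closest point in the closed set exists because the set is nonempty; the
    maximally mixed state is the witness.\<close>
  then have "closest_point density_ops X \<in> density_ops" for X :: "complex ^ 'n ^ 'n"
    using closest_point_in_set[OF closed_density_ops] by blast
  with init show ?thesis
    by (cases t) simp_all
qed

lemma dist_density_ops_le_diameter:
  fixes X Y :: "complex ^ 'n ^ 'n"
  assumes "X \<in> density_ops" "Y \<in> density_ops"
  shows "norm (X - Y) \<le> diameter (density_ops :: (complex ^ 'n ^ 'n) set)"
  using diameter_bounded_bound[OF bounded_density_ops assms] by (simp add: dist_norm)

section \<open>Tuning the step size\<close>

text \<open>In the main case \<open>\<eta>\<close> makes both terms of the regret bound equal to
  half the target. The value 1 is a positive placeholder where the quotient would be zero or have a
  zero denominator.\<close>

lemma projected_gradient_descent_regret_tuned: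
  fixes S :: "'a::{real_inner, heine_borel} set" and x g :: "nat \<Rightarrow> 'a"
  assumes S: "convex S" "closed S" "u \<in> S"
    and D: "\<And>t. t \<in> {1..T} \<Longrightarrow> norm (x t - u) \<le> D" "0 \<le> D"
    and step: "\<And>t. 1 \<le> t \<Longrightarrow> x (Suc t) = closest_point S (x t - \<eta> *\<^sub>R g t)"
    and G: "\<And>t. t \<in> {1..T} \<Longrightarrow> norm (g t) \<le> G" "0 \<le> G"
    and \<eta>: "\<eta> = (if D * G * real T = 0 then 1 else D / (G * sqrt (real T)))"
  shows "(\<Sum>t=1..T. g t \<bullet> (x t - u)) \<le> D * G * sqrt (real T)"
proof (cases "D * G * real T = 0")
  case True
  \<comment> \<open>Here \<open>D * G * real T\<close> and \<open>D * G * sqrt (real T)\<close> are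
    both zero, so summing crude bounds loses nothing.\<close>
  have "g t \<bullet> (x t - u) \<le> D * G" if "t \<in> {1..T}" for t
  proof -
    have "g t \<bullet> (x t - u) \<le> norm (g t) * norm (x t - u)"
      by (rule norm_cauchy_schwarz)
    also have "\<dots> \<le> G * D"
      using D G that by (intro mult_mono) auto
    finally show ?thesis by (simp add: mult.commute)
  qed
  then have "(\<Sum>t=1..T. g t \<bullet> (x t - u)) \<le> (\<Sum>t=1..T. D * G)"
    by (rule sum_mono)
  also have "\<dots> = D * G * real T" by simp
  finally show ?thesis using True by auto
next
  case False
  then have pos: "D > 0" "G > 0" "T > 0" using D G by auto
  then have "\<eta> > 0" using \<eta> by auto
  have "(\<Sum>t=1..T. g t \<bullet> (x t - u)) \<le> D\<^sup>2 / (2 * \<eta>) + \<eta> * G\<^sup>2 * real T / 2"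
    using S \<open>\<eta> > 0\<close> D(1)[of 1] pos step G by (intro projected_gradient_descent_regret) auto
  also have "D\<^sup>2 / (2 * \<eta>) = D * G * sqrt (real T) / 2"
    using pos unfolding \<eta> if_not_P[OF False] by (simp add: field_simps power2_eq_square)
  also have "\<eta> * G\<^sup>2 * real T / 2 = D * G * (real T / sqrt (real T)) / 2"
    using pos unfolding \<eta> if_not_P[OF False] by (simp add: field_simps power2_eq_square)
  also have "real T / sqrt (real T) = sqrt (real T)"
    by (simp add: real_div_sqrt)
  finally show ?thesis by simp
qed

section \<open>The regret of projected online gradient descent\<close>

lemma regret_le:
  fixes learner :: "(nat \<Rightarrow> real \<Rightarrow> real) \<Rightarrow> nat \<Rightarrow> complex ^ 'n ^ 'n"
  assumes "\<And>\<l> \<omega>. \<forall>t\<in>{1..T}. \<l> t \<in> F \<Longrightarrow> \<omega> \<in> density_ops \<Longrightarrow>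
    (\<Sum>t=1..T. \<l> t (Re (trace (E t ** learner \<l> t)))) - (\<Sum>t=1..T. \<l> t (Re (trace (E t ** \<omega>)))) \<le> R"
  shows "regret T F E learner \<le> ereal R"
  unfolding regret_def
proof (rule SUP_least, clarify)
  fix \<l> :: "nat \<Rightarrow> real \<Rightarrow> real"
  assume \<l>: "\<forall>t\<in>{1..T}. \<l> t \<in> F"
  let ?S = "\<Sum>t=1..T. \<l> t (Re (trace (E t ** learner \<l> t)))"
  \<comment> \<open>The bound is turned into a lower bound on the infimum, so that monotonicity of
    subtraction from the finite \<open>?S\<close> suffices, without a finiteness argument for the
    infimum.\<close>
  have "ereal (?S - R) \<le> (INF \<omega> \<in> density_ops. ereal (\<Sum>t=1..T. \<l> t (Re (trace (E t ** \<omega>)))))"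
    using assms[OF \<l>] by (intro INF_greatest) (simp add: algebra_simps)
  then have "ereal ?S - (INF \<omega> \<in> density_ops. ereal (\<Sum>t=1..T. \<l> t (Re (trace (E t ** \<omega>)))))
      \<le> ereal ?S - ereal (?S - R)"
    by (intro ereal_minus_mono) auto
  then show "ereal ?S - (INF \<omega> \<in> density_ops. ereal (\<Sum>t=1..T. \<l> t (Re (trace (E t ** \<omega>))))) \<le> ereal R"
    by simp
qed

theorem theorem4p5:
  fixes T :: nat and L B :: real
  shows "\<exists>\<eta>>0. \<forall>(E :: nat \<Rightarrow> complex ^ 'n ^ 'n) s.
    (\<forall>t\<in>{1..T}. 0 \<preceq> E t \<and> E t \<preceq> mat 1 \<and> frob_norm (E t) \<le> B) \<longrightarrow>
    subderivative_rule s \<longrightarrow>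
    regret T {f. convex_on UNIV f \<and> L-lipschitz_on UNIV f} E (ogd s \<eta> E)
      \<le> ereal (diameter (density_ops :: (complex ^ 'n ^ 'n) set) * L * B * sqrt (real T))"
proof -
  define D where "D = diameter (density_ops :: (complex ^ 'n ^ 'n) set)"
  have "D \<ge> 0"
    unfolding D_def by (rule diameter_ge_0[OF bounded_density_ops])
  \<comment> \<open>Truncation at 0 makes \<open>\<eta>\<close> positive before any round is known
    to exist: for \<open>T = 0\<close> both \<open>L\<close> and \<open>B\<close> may be
    negative.\<close>
  define G where "G = max 0 L * max 0 B"
  have "G \<ge> 0" by (simp add: G_def)
  \<comment> \<open>Only \<open>T\<close>, \<open>L\<close>, \<open>B\<close> and the diameter
    enter, so one step size serves all measurements, losses and subderivative rules.\<close>
  define \<eta> where "\<eta> = (if D * G * real T = 0 then 1 else D / (G * sqrt (real T)))"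
  have "\<eta> > 0"
    using \<open>D \<ge> 0\<close> \<open>G \<ge> 0\<close> by (auto simp: \<eta>_def)
  moreover have "regret T {f. convex_on UNIV f \<and> L-lipschitz_on UNIV f} E (ogd s \<eta> E)
      \<le> ereal (D * L * B * sqrt (real T))"
    if E: "\<forall>t\<in>{1..T}. 0 \<preceq> E t \<and> E t \<preceq> mat 1 \<and> frob_norm (E t) \<le> B" and s: "subderivative_rule s"
    for E :: "nat \<Rightarrow> complex ^ 'n ^ 'n" and s
  proof (rule regret_le)
    fix \<l> :: "nat \<Rightarrow> real \<Rightarrow> real" and \<omega> :: "complex ^ 'n ^ 'n"
    assume \<l>: "\<forall>t\<in>{1..T}. \<l> t \<in> {f. convex_on UNIV f \<and> L-lipschitz_on UNIV f}"
      and \<omega>: "\<omega> \<in> density_ops"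
    define x where "x = ogd s \<eta> E \<l>"
    define g where "g t = ogd_gradient s E \<l> t (x t)" for t
    have xS: "x t \<in> density_ops" for t
      by (simp add: x_def ogd_in_density_ops)
    \<comment> \<open>A single round forces both signs: it has an \<open>L\<close>-Lipschitz loss
      and a norm at most \<open>B\<close>.\<close>
    have LB: "L \<ge> 0 \<and> B \<ge> 0" if "t \<in> {1..T}" for t
      using that E \<l> lipschitz_on_nonneg
      by (metis (mono_tags, lifting) mem_Collect_eq frob_norm_eq_norm norm_ge_zero order_trans)
    have her: "cadjoint (E t) = E t" if "t \<in> {1..T}" for t
      using E that by (auto simp: loewner_le_def psd_def)
    define c where "c t = s t (\<l> t) (E t \<bullet> x t)" for t
    \<comment> \<open>The algorithm evaluates the trace of \<open>x t ** E t\<close>, the regret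
      that of \<open>E t ** x t\<close>; cyclicity of the trace identifies them.\<close>
    have g: "g t = c t *\<^sub>R E t" if "t \<in> {1..T}" for t
      using trace_hermitian_mult_eq_inner[OF her[OF that], of "x t"]
      by (simp add: g_def c_def ogd_gradient_def trace_mul_sym[of "x t"])
    have c: "is_subderivative (\<l> t) (E t \<bullet> x t) (c t)" if "t \<in> {1..T}" for t
      using s \<l> that by (auto simp: subderivative_rule_def c_def)
    have "norm (g t) \<le> G" if "t \<in> {1..T}" for t
    proof -
      have "\<bar>c t\<bar> \<le> L"
        using subderivative_abs_le_lipschitz[OF c[OF that]] \<l> that by auto
      moreover have "norm (E t) \<le> B"
        using E that by (auto simp: frob_norm_eq_norm)
      ultimately show ?thesis
        using LB[OF that] by (simp add: g[OF that] G_def mult_mono)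
    qed
    \<comment> \<open>The case \<open>t = 0\<close> is excluded because \<open>ogd\<close> sets
      round 1 to the maximally mixed state instead of projecting.\<close>
    moreover have "x (Suc t) = closest_point density_ops (x t - \<eta> *\<^sub>R g t)" if "1 \<le> t" for t
      using that by (simp add: x_def g_def)
    ultimately have bound: "(\<Sum>t=1..T. g t \<bullet> (x t - \<omega>)) \<le> D * G * sqrt (real T)"
      using \<open>D \<ge> 0\<close> \<open>G \<ge> 0\<close> \<omega> xS
      by (intro projected_gradient_descent_regret_tuned[where S = density_ops and \<eta> = \<eta>])
         (auto simp: convex_density_ops closed_density_ops D_def dist_density_ops_le_diameter \<eta>_def)
    have "(\<Sum>t=1..T. \<l> t (Re (trace (E t ** x t)))) - (\<Sum>t=1..T. \<l> t (Re (trace (E t ** \<omega>))))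
        = (\<Sum>t=1..T. \<l> t (E t \<bullet> x t) - \<l> t (E t \<bullet> \<omega>))"
      by (simp add: trace_hermitian_mult_eq_inner her flip: sum_subtractf)
    also have "\<dots> \<le> (\<Sum>t=1..T. g t \<bullet> (x t - \<omega>))"
    proof (rule sum_mono)
      fix t assume t: "t \<in> {1..T}"
      have "\<l> t (E t \<bullet> x t) + c t * (E t \<bullet> \<omega> - E t \<bullet> x t) \<le> \<l> t (E t \<bullet> \<omega>)"
        using c[OF t] by (simp add: is_subderivative_def)
      then show "\<l> t (E t \<bullet> x t) - \<l> t (E t \<bullet> \<omega>) \<le> g t \<bullet> (x t - \<omega>)"
        by (simp add: g[OF t] inner_diff_right algebra_simps)
    qed
    also note bound
    \<comment> \<open>The truncation in \<open>G\<close> is undone: some round gives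
      \<open>L\<close> and \<open>B\<close> their signs, and for \<open>T = 0\<close> both sides
      vanish.\<close>
    also have "D * G * sqrt (real T) = D * L * B * sqrt (real T)"
    proof (cases "T = 0")
      case False
      then have "L \<ge> 0 \<and> B \<ge> 0" using LB[of 1] by auto
      then show ?thesis by (simp add: G_def)
    qed simp
    finally show "(\<Sum>t=1..T. \<l> t (Re (trace (E t ** ogd s \<eta> E \<l> t)))) -
        (\<Sum>t=1..T. \<l> t (Re (trace (E t ** \<omega>)))) \<le> D * L * B * sqrt (real T)"
      by (simp add: x_def)
  qed
  ultimately show ?thesis unfolding D_def by blast
qed

end
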